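(* Let $H$ be the Hilbert transform on $\mathbb R$ and let $\varepsilon_0(p)$ be the John--Nirenberg constant of $\mathrm{BMO}^p((0,1))$ (defined in the context). For every $p\in[1,2]$, $$\|H\|_{L^\infty(\mathbb R)\to\mathrm{BMO}^p(\mathbb R)}\ge\frac2\pi\,\varepsilon_0(p).$$
   Context: For an interval $J$, $\langle\varphi\rangle_J=\frac1{|J|}\int_J\varphi$. Let $X$ be a bounded interval or $\mathbb R$. For $p>0$, $\|\varphi\|_{\mathrm{BMO}^p(X)}=\sup_{J\subset X}\langle|\varphi-\langle\varphi\rangle_J|^p\rangle_J^{1/p}$, the supremum being over all bounded intervals $J\subset X$; $\mathrm{BMO}(X)$ is the set of locally integrable $\varphi$ for which this is finite (the set is the same for all $p>0$). The Hilbert transform is $Hf(x)=\frac1\pi\,\mathrm{p.v.}\int_{\mathbb R}\frac1{x-y}f(y)\,dy$; for $f\in L^\infty(\mathbb R)$ it is defined, as usual, as an element of $\mathrm{BMO}(\mathbb R)$ modulo additive constants (subtracting a suitable constant in the kernel to ensure convergence). The norm is $\|H\|_{L^\infty\to\mathrm{BMO}^p}=\sup\{\|Hf\|_{\mathrm{BMO}^p(\mathbb R)}:\ \|f\|_{L^\infty(\mathbb R)}\le1\}$. For $p>0$ and $\varepsilon\ge0$ let $C(\varepsilon,p)\in[1,\infty]$ be the smallest constant such that $\langle e^\varphi\rangle_J\le C(\varepsilon,p)\,e^{\langle\varphi\rangle_J}$ for every $\varphi\in\mathrm{BMO}((0,1))$ with $\|\varphi\|_{\mathrm{BMO}^p((0,1))}\le\varepsilon$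 and every subinterval $J\subset(0,1)$. The John--Nirenberg constant $\varepsilon_0(p)$ is the largest number such that $C(\varepsilon,p)<\infty$ for all $0\le\varepsilon<\varepsilon_0(p)$. *)

theory Defs
  imports "HOL-Analysis.Analysis" "HOL-Probability.Essential_Supremum"
begin

definition intervals_in :: "real set \<Rightarrow> real set set" where
  "intervals_in X = {J. is_interval J \<and> bounded J \<and> measure lebesgue J > 0 \<and> J \<subseteq> X}"

definition avg :: "(real \<Rightarrow> real) \<Rightarrow> real set \<Rightarrow> real" where
  "avg \<phi> J = (LINT x:J|lebesgue. \<phi> x) / measure lebesgue J"

text \<open>Averages of nonnegative functions, with value \<open>\<infinity>\<close> when the integral diverges.\<close>

definition nn_avg :: "(real \<Rightarrow> ennreal) \<Rightarrow> real set \<Rightarrow> ennreal" where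
  "nn_avg g J = (\<integral>\<^sup>+x\<in>J. g x \<partial>lebesgue) / emeasure lebesgue J"

text \<open>Meant for exponents \<open>r > 0\<close> only.\<close>

definition ennreal_powr :: "ennreal \<Rightarrow> real \<Rightarrow> ennreal" where
  "ennreal_powr x r = (if x = \<infinity> then \<infinity> else ennreal (enn2real x powr r))"

definition bmo_norm :: "real \<Rightarrow> real set \<Rightarrow> (real \<Rightarrow> real) \<Rightarrow> ennreal" where
  "bmo_norm p X \<phi> =
     (SUP J\<in>intervals_in X. ennreal_powr (nn_avg (\<lambda>x. ennreal (\<bar>\<phi> x - avg \<phi> J\<bar> powr p)) J) (1 / p))"

definition locally_integrable_on :: "(real \<Rightarrow> real) \<Rightarrow> real set \<Rightarrow> bool" where
  "locally_integrable_on \<phi> X \<longleftrightarrow> (\<forall>K. compact K \<and> K \<subseteq> X \<longrightarrow> set_integrable lebesgue K \<phi>)"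

definition BMO :: "real \<Rightarrow> real set \<Rightarrow> (real \<Rightarrow> real) set" where
  "BMO p X = {\<phi>. locally_integrable_on \<phi> X \<and> bmo_norm p X \<phi> < \<infinity>}"

text \<open>
  The Hilbert transform of a bounded function. The term \<open>1 / y\<close> for \<open>\<bar>y\<bar> > 1\<close> does not depend
  on \<open>x\<close>; it makes the truncated integrals absolutely convergent and so picks one representative
  of the class of \<open>Hf\<close> modulo constants. The limit exists for almost every \<open>x\<close>; on the
  exceptional null set the value is immaterial.
\<close>

definition hilbert_transform :: "(real \<Rightarrow> real) \<Rightarrow> real \<Rightarrow> real" where
  "hilbert_transform f x =
     1 / pi * Lim (at_right 0) (\<lambda>\<delta>. LINT y:{y. \<delta> < \<bar>x - y\<bar>}|lebesgue.
       (1 / (x - y) + (if \<bar>y\<bar> > 1 then 1 / y else 0)) * f y)"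

definition hilbert_norm :: "real \<Rightarrow> ennreal" where
  "hilbert_norm p =
     (SUP f\<in>{f. f \<in> borel_measurable lebesgue \<and> esssup lebesgue (\<lambda>x. ennreal \<bar>f x\<bar>) \<le> 1}.
        bmo_norm p UNIV (hilbert_transform f))"

definition JN_C :: "real \<Rightarrow> real \<Rightarrow> ennreal" where
  "JN_C \<epsilon> p = Inf {C. \<forall>\<phi>\<in>BMO p {0<..<1}. bmo_norm p {0<..<1} \<phi> \<le> ennreal \<epsilon> \<longrightarrow>
     (\<forall>J\<in>intervals_in {0<..<1}.
        nn_avg (\<lambda>x. ennreal (exp (\<phi> x))) J \<le> C * ennreal (exp (avg \<phi> J)))}"

definition JN_constant :: "real \<Rightarrow> ennreal" where
  "JN_constant p = Sup {e. \<forall>\<epsilon>::real. 0 \<le> \<epsilon> \<and> ennreal \<epsilon> < e \<longrightarrow> JN_C \<epsilon> p < \<infinity>}"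

end

theory Submission
  imports Defs
begin

text \<open>
  The step function \<open>f = 1\<close> on \<open>[-1,0]\<close>, \<open>f = -1\<close> on \<open>(0,1)\<close>, and \<open>0\<close> elsewhere has
  \<open>\<pi>/2 \<cdot> Hf(x) = (ln(1+x) + ln(1-x))/2 - ln x\<close> on \<open>(0,1)\<close>. The exponential of this function
  behaves like \<open>1/x\<close> at the origin and so is not integrable. Hence \<open>\<epsilon>\<^sub>0(p)\<close> is at most the
  \<open>BMO\<^sup>p\<close> norm of \<open>\<pi>/2 \<cdot> Hf\<close>.
\<close>

section \<open>The functional \<open>bmo_norm\<close> under restriction and scaling, and its
  relation to \<open>JN_constant\<close>\<close>

lemma bmo_norm_mono_domain: "X \<subseteq> Y \<Longrightarrow> bmo_norm p X \<phi> \<le> bmo_norm p Y \<phi>"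
  unfolding bmo_norm_def by (rule SUP_subset_mono) (auto simp: intervals_in_def)

lemma intervals_in_sets: "J \<in> intervals_in X \<Longrightarrow> J \<in> sets lebesgue"
  by (simp add: intervals_in_def real_interval_borel_measurable sets_completionI_sets)

lemma avg_cong: "(\<And>x. x \<in> J \<Longrightarrow> \<phi> x = \<psi> x) \<Longrightarrow> avg \<phi> J = avg \<psi> J"
  unfolding avg_def set_lebesgue_integral_def
  by (intro arg_cong2[where f="(/)"] Bochner_Integration.integral_cong) (auto simp: indicator_def)

lemma nn_avg_cong: "(\<And>x. x \<in> J \<Longrightarrow> g x = h x) \<Longrightarrow> nn_avg g J = nn_avg h J"
  unfolding nn_avg_def
  by (intro arg_cong2[where f="(/)"] nn_integral_cong) (auto simp: indicator_def)

lemma bmo_norm_cong: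
  assumes "\<And>x. x \<in> X \<Longrightarrow> \<phi> x = \<psi> x"
  shows "bmo_norm p X \<phi> = bmo_norm p X \<psi>"
  unfolding bmo_norm_def
proof (rule SUP_cong[OF refl])
  fix J assume "J \<in> intervals_in X"
  then have eq: "\<phi> x = \<psi> x" if "x \<in> J" for x
    using assms that by (auto simp: intervals_in_def)
  show "ennreal_powr (nn_avg (\<lambda>x. ennreal (\<bar>\<phi> x - avg \<phi> J\<bar> powr p)) J) (1 / p) =
        ennreal_powr (nn_avg (\<lambda>x. ennreal (\<bar>\<psi> x - avg \<psi> J\<bar> powr p)) J) (1 / p)"
    by (intro arg_cong2[where f=ennreal_powr] nn_avg_cong refl) (simp add: eq avg_cong[OF eq])
qed

lemma ennreal_powr_mult_powr:
  assumes "c > 0" "p > 0"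
  shows "ennreal_powr (ennreal (c powr p) * a) (1 / p) = ennreal c * ennreal_powr a (1 / p)"
proof (cases a)
  case (real r)
  then show ?thesis using assms
    by (simp add: ennreal_powr_def ennreal_mult[symmetric] powr_mult powr_powr)
next
  case top
  \<comment> \<open>Since \<open>c > 0\<close>, both products stay infinite.\<close>
  then show ?thesis using assms by (simp add: ennreal_powr_def ennreal_mult_top)
qed

lemma bmo_norm_cmult:
  assumes [measurable]: "\<phi> \<in> borel_measurable lebesgue" and c: "c > 0" and p: "p > 0"
  shows "bmo_norm p X (\<lambda>x. c * \<phi> x) = ennreal c * bmo_norm p X \<phi>"
  unfolding bmo_norm_def SUP_mult_left_ennreal
proof (rule SUP_cong[OF refl])
  fix J assume "J \<in> intervals_in X"
  then have [measurable]: "J \<in> sets lebesgue" by (rule intervals_in_sets)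
  \<comment> \<open>Holds also on intervals where \<open>\<phi>\<close> is not integrable: both
    Bochner integrals are then 0.\<close>
  have avg: "avg (\<lambda>x. c * \<phi> x) J = c * avg \<phi> J"
    by (simp add: avg_def)
  have "nn_avg (\<lambda>x. ennreal (\<bar>c * \<phi> x - avg (\<lambda>x. c * \<phi> x) J\<bar> powr p)) J
      = nn_avg (\<lambda>x. ennreal (c powr p) * ennreal (\<bar>\<phi> x - avg \<phi> J\<bar> powr p)) J"
    using c by (intro nn_avg_cong)
      (simp add: avg ennreal_mult[symmetric] powr_mult[symmetric] abs_mult right_diff_distrib[symmetric])
  also have "\<dots> = ennreal (c powr p) * nn_avg (\<lambda>x. ennreal (\<bar>\<phi> x - avg \<phi> J\<bar> powr p)) J"
    unfolding nn_avg_def mult.assoc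
    by (subst nn_integral_cmult) (measurable, simp add: ennreal_times_divide)
  finally show "ennreal_powr (nn_avg (\<lambda>x. ennreal (\<bar>c * \<phi> x - avg (\<lambda>x. c * \<phi> x) J\<bar> powr p)) J) (1 / p)
      = ennreal c * ennreal_powr (nn_avg (\<lambda>x. ennreal (\<bar>\<phi> x - avg \<phi> J\<bar> powr p)) J) (1 / p)"
    by (simp add: ennreal_powr_mult_powr[OF c p])
qed

text \<open>With \<epsilon> the norm of \<open>\<phi>\<close>, this function itself is admissible in
  \<open>JN_C \<epsilon> p\<close>, and on \<open>J = {0<..<1}\<close> it violates the exponential
  bound for every finite constant. Hence \<open>JN_C\<close> is already infinite at \<epsilon>, and
  no threshold can exceed \<epsilon>.\<close>

lemma JN_constant_le_bmo_norm:
  assumes loc: "locally_integrable_on \<phi> {0<..<1}"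
    and inf: "(\<integral>\<^sup>+x\<in>{0<..<1}. ennreal (exp (\<phi> x)) \<partial>lebesgue) = \<infinity>"
  shows "JN_constant p \<le> bmo_norm p {0<..<1} \<phi>"
proof (cases "bmo_norm p {0<..<1} \<phi>")
  case top
  then show ?thesis by simp
next
  case (real \<epsilon>)
  have J: "{0<..<1::real} \<in> intervals_in {0<..<1}"
    by (simp add: intervals_in_def is_interval_1)
  have "C = \<infinity>" if C: "\<forall>\<phi>\<in>BMO p {0<..<1}. bmo_norm p {0<..<1} \<phi> \<le> ennreal \<epsilon> \<longrightarrow>
     (\<forall>J\<in>intervals_in {0<..<1}.
        nn_avg (\<lambda>x. ennreal (exp (\<phi> x))) J \<le> C * ennreal (exp (avg \<phi> J)))" for C
  proof -
    have "\<phi> \<in> BMO p {0<..<1}" using loc real by (simp add: BMO_def)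
    then have "nn_avg (\<lambda>x. ennreal (exp (\<phi> x))) {0<..<1} \<le> C * ennreal (exp (avg \<phi> {0<..<1}))"
      using C J real by simp
    moreover have "nn_avg (\<lambda>x. ennreal (exp (\<phi> x))) {0<..<1} = \<infinity>"
      using inf by (simp add: nn_avg_def ennreal_top_divide)
    ultimately show ?thesis by (auto simp: top_unique ennreal_mult_eq_top_iff)
  qed
  then have "JN_C \<epsilon> p = \<infinity>"
    unfolding JN_C_def by (intro Inf_eqI) auto
  then have "e \<le> ennreal \<epsilon>"
    if "\<forall>\<epsilon>::real. 0 \<le> \<epsilon> \<and> ennreal \<epsilon> < e \<longrightarrow> JN_C \<epsilon> p < \<infinity>" for e
    using that real by (metis less_irrefl not_le)
  then show ?thesis
    unfolding JN_constant_def real by (intro Sup_least) auto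
qed

section \<open>The Cauchy kernel and the Hilbert transform of the step function\<close>

lemma
  fixes x a b :: real
  assumes "a \<le> b" "x < a \<or> b < x"
  shows set_integrable_cauchy_kernel: "set_integrable lebesgue {a..b} (\<lambda>y. 1 / (x - y))"
    and set_integral_cauchy_kernel:
      "(LINT y:{a..b}|lebesgue. 1 / (x - y)) = ln (abs (x - a)) - ln (abs (x - b))"
proof -
  show int: "set_integrable lebesgue {a..b} (\<lambda>y. 1 / (x - y))"
    using assms by (intro absolutely_integrable_continuous_real continuous_intros) auto
  have "((\<lambda>y. 1 / (x - y)) has_integral (- ln (abs (x - b)) - (- ln (abs (x - a))))) {a..b}"
  proof (rule fundamental_theorem_of_calculus[OF assms(1)])
    fix y assume y: "y \<in> {a..b}"
    \<comment> \<open>As \<open>x\<close> lies outside \<open>{a..b}\<close>, the antiderivative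
      \<open>- ln (abs (x - y))\<close> is smooth there; the case split fixes the sign of
      \<open>x - y\<close>.\<close>
    have "((\<lambda>y. - ln (abs (x - y))) has_real_derivative 1 / (x - y)) (at y within {a..b})"
    proof (cases "x < a")
      case True
      have "((\<lambda>y. - ln (y - x)) has_real_derivative 1 / (x - y)) (at y within {a..b})"
        using True y by (auto intro!: derivative_eq_intros simp: divide_simps)
      then show ?thesis
        \<comment> \<open>The radius is arbitrary, since the two functions agree on all of
          \<open>{a..b}\<close>.\<close>
        by (rule has_field_derivative_transform_within[where d=1]) (use True y in auto)
    next
      case False
      with assms have x: "b < x" by simp
      have "((\<lambda>y. - ln (x - y)) has_real_derivative 1 / (x - y)) (at y within {a..b})"
        using x y by (auto intro!: derivative_eq_intros simp: divide_simps)
      then show ?thesis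
        by (rule has_field_derivative_transform_within[where d=1]) (use x y in auto)
    qed
    then show "((\<lambda>y. - ln (abs (x - y))) has_vector_derivative 1 / (x - y)) (at y within {a..b})"
      by (simp add: has_real_derivative_iff_has_vector_derivative)
  qed
  then show "(LINT y:{a..b}|lebesgue. 1 / (x - y)) = ln (abs (x - a)) - ln (abs (x - b))"
    by (simp add: set_lebesgue_integral_eq_integral(2)[OF int] integral_unique)
qed

text \<open>The truncation \<open>\<delta> < \<bar>x - y\<bar>\<close> is strict and so leaves open
  intervals. Removing the two endpoints does not change the integral.\<close>

lemma
  fixes x a b :: real
  assumes "a \<le> b" "x < a \<or> b < x"
  shows set_integrable_cauchy_kernel_Ioo: "set_integrable lebesgue {a<..<b} (\<lambda>y. 1 / (x - y))"
    and set_integral_cauchy_kernel_Ioo: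
      "(LINT y:{a<..<b}|lebesgue. 1 / (x - y)) = ln (abs (x - a)) - ln (abs (x - b))"
proof -
  note cl = set_integrable_cauchy_kernel[OF assms]
  show op: "set_integrable lebesgue {a<..<b} (\<lambda>y. 1 / (x - y))"
    by (rule set_integrable_subset[OF cl]) auto
  show "(LINT y:{a<..<b}|lebesgue. 1 / (x - y)) = ln (abs (x - a)) - ln (abs (x - b))"
    using set_integral_cauchy_kernel[OF assms]
    by (simp add: set_lebesgue_integral_eq_integral(2)[OF cl]
        set_lebesgue_integral_eq_integral(2)[OF op] integral_open_interval_real)
qed

text \<open>The jump of size 2 at 0 is the largest compatible with
  \<open>\<bar>f\<bar> \<le> 1\<close>; it yields the logarithmic singularity with coefficient
  2/\<pi>. The support lies in [-1,1], where the correction term of the kernel vanishes.\<close>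

definition step_fun :: "real \<Rightarrow> real" where
  "step_fun y = indicator {-1..0} y - indicator {0<..<1} y"

definition log_profile :: "real \<Rightarrow> real" where
  "log_profile x = (ln (1 + x) + ln (1 - x)) / 2 - ln x"

text \<open>The deleted interval around \<open>x\<close> lies inside (0,1), where
  \<open>step_fun\<close> is constant. The terms \<open>ln \<delta>\<close> from its two sides
  therefore cancel, and the truncated integral does not depend on \<delta>.\<close>

lemma truncated_hilbert_step_fun:
  fixes x \<delta> :: real
  assumes "0 < x" "x < 1" "0 < \<delta>" "\<delta> < x" "\<delta> < 1 - x"
  shows "(LINT y:{y. \<delta> < \<bar>x - y\<bar>}|lebesgue.
       (1 / (x - y) + (if \<bar>y\<bar> > 1 then 1 / y else 0)) * step_fun y) = 2 * log_profile x"
proof -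
  let ?k = "\<lambda>y. 1 / (x - y)"
  have eq: "indicator {y. \<delta> < \<bar>x - y\<bar>} y *\<^sub>R ((?k y + (if \<bar>y\<bar> > 1 then 1 / y else 0)) * step_fun y)
    = indicator {-1..0} y *\<^sub>R ?k y - indicator {0<..<x-\<delta>} y *\<^sub>R ?k y - indicator {x+\<delta><..<1} y *\<^sub>R ?k y"
    for y using assms unfolding step_fun_def by (auto simp: indicator_def)
  have "(LINT y:{y. \<delta> < \<bar>x - y\<bar>}|lebesgue.
       (1 / (x - y) + (if \<bar>y\<bar> > 1 then 1 / y else 0)) * step_fun y)
    = (LINT y:{-1..0}|lebesgue. ?k y) - (LINT y:{0<..<x-\<delta>}|lebesgue. ?k y)
      - (LINT y:{x+\<delta><..<1}|lebesgue. ?k y)"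
    using set_integrable_cauchy_kernel[of "-1" 0 x] set_integrable_cauchy_kernel_Ioo[of 0 "x-\<delta>" x]
      set_integrable_cauchy_kernel_Ioo[of "x+\<delta>" 1 x] assms
    unfolding set_lebesgue_integral_def set_integrable_def eq by simp
  also have "\<dots> = 2 * log_profile x"
    using assms
    by (simp add: set_integral_cauchy_kernel set_integral_cauchy_kernel_Ioo log_profile_def
        algebra_simps)
  finally show ?thesis .
qed

lemma hilbert_transform_step_fun:
  assumes "0 < x" "x < 1"
  shows "hilbert_transform step_fun x = 2 / pi * log_profile x"
proof -
  \<comment> \<open>The principal value is the limit of an eventually constant function; below
    \<open>min x (1 - x)\<close> the deleted interval stays inside (0,1).\<close>
  have "\<forall>\<^sub>F \<delta> in at_right 0. (LINT y:{y. \<delta> < \<bar>x - y\<bar>}|lebesgue.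
       (1 / (x - y) + (if \<bar>y\<bar> > 1 then 1 / y else 0)) * step_fun y) = 2 * log_profile x"
    using assms by (intro eventually_at_rightI[of 0 "min x (1 - x)"] truncated_hilbert_step_fun) auto
  then have "Lim (at_right 0) (\<lambda>\<delta>. LINT y:{y. \<delta> < \<bar>x - y\<bar>}|lebesgue.
       (1 / (x - y) + (if \<bar>y\<bar> > 1 then 1 / y else 0)) * step_fun y) = 2 * log_profile x"
    by (intro tendsto_Lim tendsto_eventually) auto
  then show ?thesis by (simp add: hilbert_transform_def)
qed

section \<open>Local integrability of the profile and divergence of its exponential integral\<close>

lemma locally_integrable_log_profile: "locally_integrable_on log_profile {0<..<1}"
  unfolding locally_integrable_on_def
proof safe
  fix K :: "real set" assume K: "compact K" "K \<subseteq> {0<..<1}"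
  have pos: "0 < x" "x < 1" if "x \<in> K" for x using K that by auto
  \<comment> \<open>The singularities at 0 and 1 lie outside \<open>K\<close>, so continuity on a
    compact set suffices.\<close>
  have "continuous_on K log_profile"
    unfolding log_profile_def by (intro continuous_intros) (use pos in force)+
  with K(1) show "set_integrable lebesgue K log_profile"
    using borel_integrable_compact[of K log_profile]
    by (auto simp: set_integrable_def indicator_def if_distrib cong: if_cong
        intro!: integrable_completion[THEN iffD2])
qed

text \<open>On (0,1) the exponential equals sqrt(1 - x^2) / x, and for \<open>x \<le> 1 / 2\<close>
  the crude bound \<open>1 / 4 \<le> (1 + x) * (1 - x)\<close> makes the root at least 1/2.\<close>

lemma exp_log_profile_ge:
  assumes "0 < x" "x \<le> 1 / 2"
  shows "1 / (2 * x) \<le> exp (log_profile x)"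
proof -
  have "- ln 2 = ln (1 / 4 :: real) / 2"
    using ln_realpow[of "1/2::real" 2] by (simp add: ln_div power2_eq_square)
  also have "\<dots> \<le> ln ((1 + x) * (1 - x)) / 2"
  proof -
    have "1 / 4 \<le> 1 * (1 - x)" using assms by simp
    also have "\<dots> \<le> (1 + x) * (1 - x)" using assms by (intro mult_right_mono) auto
    finally show ?thesis using assms by (intro divide_right_mono ln_mono) auto
  qed
  also have "\<dots> = (ln (1 + x) + ln (1 - x)) / 2"
    using assms by (simp add: ln_mult)
  finally have "exp (- ln 2 - ln x) \<le> exp (log_profile x)"
    by (simp add: log_profile_def)
  moreover have "- ln 2 - ln x = ln (1 / (2 * x))"
    using assms by (simp add: ln_div ln_mult)
  ultimately show ?thesis using assms by simp
qed

lemma nn_integral_exp_log_profile: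
  "(\<integral>\<^sup>+x\<in>{0<..<1}. ennreal (exp (log_profile x)) \<partial>lebesgue) = \<infinity>"
proof -
  let ?I = "\<integral>\<^sup>+x\<in>{0<..<1}. ennreal (exp (log_profile x)) \<partial>lebesgue"
  have ge: "ennreal r \<le> ?I" if r: "r \<ge> 0" for r
  proof -
    \<comment> \<open>Chosen so that the integral of 1/(2y) over \<open>{a..1/2}\<close>, which is
      (ln (1/2) - ln a)/2, equals \<open>r\<close>.\<close>
    define a :: real where "a = exp (- (2 * r)) / 2"
    have a: "0 < a" "a \<le> 1 / 2" using r by (auto simp: a_def)
    \<comment> \<open>The Cauchy kernel at \<open>x = 0\<close> is -1/y; the factor
      \<open>- 1 / 2\<close> below turns it into the minorant 1/(2y).\<close>
    have int: "integrable lebesgue (\<lambda>y. indicator {a..1/2} y *\<^sub>R (1 / (0 - y)))"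
      and val: "(LINT y|lebesgue. indicator {a..1/2} y *\<^sub>R (1 / (0 - y))) = - (2 * r)"
      using set_integrable_cauchy_kernel[of a "1/2" 0] set_integral_cauchy_kernel[of a "1/2" 0] a
      by (simp_all add: set_integrable_def set_lebesgue_integral_def a_def ln_div)
    have "ennreal r = ennreal (LINT y|lebesgue. - 1 / 2 * (indicator {a..1/2} y *\<^sub>R (1 / (0 - y))))"
      by (subst integral_mult_right_zero) (simp only: val, simp)
    also have "\<dots> = (\<integral>\<^sup>+y. ennreal (- 1 / 2 * (indicator {a..1/2} y *\<^sub>R (1 / (0 - y)))) \<partial>lebesgue)"
      using int a
      by (intro nn_integral_eq_integral[symmetric] integrable_mult_right) (auto simp: indicator_def)
    also have "\<dots> \<le> ?I"
      using a exp_log_profile_ge by (intro nn_integral_mono) (auto simp: indicator_def)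
    finally show ?thesis .
  qed
  show ?thesis
  proof (cases ?I)
    case (real s)
    \<comment> \<open>A finite value \<open>s\<close> would have to be at least
      \<open>s + 1\<close>.\<close>
    with ge[of "s + 1"] show ?thesis by simp
  qed simp
qed

theorem corollary1p6:
  fixes p :: real
  assumes "1 \<le> p" and "p \<le> 2"
  shows "hilbert_norm p \<ge> ennreal (2 / pi) * JN_constant p"
proof -
  have meas: "log_profile \<in> borel_measurable lebesgue"
    unfolding log_profile_def[abs_def] by (intro measurable_completion) simp
  have step: "step_fun \<in> borel_measurable lebesgue"
    unfolding step_fun_def[abs_def] by (intro measurable_completion) simp
  have "ennreal (2 / pi) * JN_constant p \<le> ennreal (2 / pi) * bmo_norm p {0<..<1} log_profile"
    by (intro mult_left_mono JN_constant_le_bmo_norm locally_integrable_log_profile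
        nn_integral_exp_log_profile) simp
  also have "\<dots> = bmo_norm p {0<..<1} (\<lambda>x. 2 / pi * log_profile x)"
    using assms by (intro bmo_norm_cmult[symmetric] meas) auto
  \<comment> \<open>The closed form of the transform is available on (0,1) only, so the functions
    are identified there before the domain is enlarged to the whole line.\<close>
  also have "\<dots> = bmo_norm p {0<..<1} (hilbert_transform step_fun)"
    by (intro bmo_norm_cong) (simp add: hilbert_transform_step_fun)
  also have "\<dots> \<le> bmo_norm p UNIV (hilbert_transform step_fun)"
    by (rule bmo_norm_mono_domain) simp
  also have "\<dots> \<le> hilbert_norm p"
    unfolding hilbert_norm_def
  proof (rule SUP_upper, safe)
    show "esssup lebesgue (\<lambda>x. ennreal \<bar>step_fun x\<bar>) \<le> 1"
    proof (rule esssup_I)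
      show "(\<lambda>x. ennreal \<bar>step_fun x\<bar>) \<in> borel_measurable lebesgue"
        using step by measurable
      show "AE x in lebesgue. ennreal \<bar>step_fun x\<bar> \<le> 1"
        by (intro AE_I2) (auto simp: step_fun_def indicator_def)
    qed
  qed (rule step)
  finally show ?thesis .
qed

end
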